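(* For every real $\alpha$ with $0<\alpha<1$ there exists a constant $C=C(\alpha)>0$ such that for every function $p=p(n)$ with $C/n\le p\le 1$, with high probability $\alpha n$ cops do not suffice to catch the robber on the random graph $G_{n,p}$; that is, $\Pr[\mathrm{ent}(G_{n,p})>\alpha n]\to 1$ as $n\to\infty$. The same result holds for directed random graphs: for every $0<\alpha<1$ there is a constant $C>0$ such that for every $p=p(n)$ with $C/n\le p\le 1$, with high probability $\alpha n$ cops do not suffice to catch the robber on the directed random graph on $n$ vertices with arc probability $p$.
   Context: Entanglement game on a finite (directed or undirected) graph $G$ with $k$ cops: First the robber chooses a starting vertex, and all $k$ cops are outside the graph. In every turn, the cops either all stay where they are, or exactly one of them flies (from wherever it is, on or off the graph) to the current position of the robber. Regardless of which of these happened, the robber then has to move to a neighbor of his current position (in a directed graph: a successor, i.e. an out-neighbor) that is not occupied by a cop. If there is no such neighbor, the cops win. The robber wins if he can run away indefinitely. Both sides have full information. The entanglement number $\mathrm{ent}(G)$ is the minimal integer $k$ such that $k$ cops have a strategy to catch the robber on $G$. "$\alpha n$ cops do not suffice" means that no integer number $k\le\alpha n$ of cops can catch the robber, i.e. $\mathrm{ent}(G)>\alpha n$. $G_{n,p}$ is the Erdős–Rényi random graph on $n$ vertices in which each unordered pair of distinct vertices is an edge independently with probability $p$. In the directed random graph each ordered pair $(u,v)$ of distinct vertices is an arc independently with probability $p$. "With high probability" means with probability tending to $1$ as $n\to\infty$. *)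

theory Defs
  imports "HOL-Probability.Probability" "Graph_Theory.Pair_Digraph"
begin

(* An undirected graph is represented by the digraph containing both orientations of every edge. *)

(* A strategy for the cops maps the positions of the robber so far (the last entry being the
   current one) to None (all cops stay) or Some i (cop i flies to the robber's position).
   As the strategy is deterministic, these positions determine the moves of the cops so far. *)
type_synonym 'a cop_strategy = "'a list \<Rightarrow> nat option"

(* The position of each cop just before the cops' move number t (counting from 0) against the
   robber trajectory r; None means outside the graph. *)
primrec cop_position :: "'a cop_strategy \<Rightarrow> (nat \<Rightarrow> 'a) \<Rightarrow> nat \<Rightarrow> nat \<Rightarrow> 'a option" where
  "cop_position \<sigma> r 0 = (\<lambda>i. None)"
| "cop_position \<sigma> r (Suc t) =
     (case \<sigma> (map r [0..<Suc t]) of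
        None \<Rightarrow> cop_position \<sigma> r t
      | Some i \<Rightarrow> (cop_position \<sigma> r t)(i := Some (r t)))"

definition robber_escapes :: "'a pair_pre_digraph \<Rightarrow> 'a cop_strategy \<Rightarrow> (nat \<Rightarrow> 'a) \<Rightarrow> bool" where
  "robber_escapes G \<sigma> r \<longleftrightarrow> r 0 \<in> pverts G \<and>
     (\<forall>t. (r t, r (Suc t)) \<in> parcs G \<and> (\<forall>i. cop_position \<sigma> r (Suc t) i \<noteq> Some (r (Suc t))))"

definition cops_catch :: "'a pair_pre_digraph \<Rightarrow> nat \<Rightarrow> bool" where
  "cops_catch G k \<longleftrightarrow>
     (\<exists>\<sigma>. (\<forall>h i. \<sigma> h = Some i \<longrightarrow> i < k) \<and> \<not> (\<exists>r. robber_escapes G \<sigma> r))"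

definition entanglement :: "'a pair_pre_digraph \<Rightarrow> nat" where
  "entanglement G = (LEAST k. cops_catch G k)"

(* Hence the LEAST above is attained on every finite graph. *)
lemma cops_catch_card:
  assumes "pair_wf_digraph G" and "finite (pverts G)"
  shows "cops_catch G (card (pverts G))"
proof -
  interpret pair_wf_digraph G by fact
  obtain f where f: "bij_betw f (pverts G) {..<card (pverts G)}"
    using assms(2) finite_same_card_bij[of "pverts G" "{..<card (pverts G)}"] by auto
  define \<sigma> where "\<sigma> h = (if last h \<in> pverts G then Some (f (last h)) else None)" for h
  have legal: "\<sigma> h = Some i \<Longrightarrow> i < card (pverts G)" for h i
    using f by (auto simp: \<sigma>_def bij_betw_def split: if_splits)
  have False if esc: "robber_escapes G \<sigma> r" for r
  proof -
    have V: "r t \<in> pverts G" for t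
      using esc in_arcsD1 by (auto simp: robber_escapes_def)
    have occ: "s < t \<Longrightarrow> cop_position \<sigma> r t (f (r s)) = Some (r s)" for s t
    proof (induction t)
      case (Suc t)
      have "f (r s) = f (r t) \<Longrightarrow> r s = r t"
        using f V by (auto simp: bij_betw_def inj_on_def)
      with Suc V show ?case
        by (auto simp: \<sigma>_def less_Suc_eq)
    qed simp
    have "r s \<noteq> r t" if "s < t" for s t
    proof -
      obtain t' where t': "t = Suc t'" using \<open>s < t\<close> by (cases t) auto
      have "cop_position \<sigma> r (Suc t') (f (r s)) \<noteq> Some (r (Suc t'))"
        using esc unfolding robber_escapes_def by blast
      with occ[OF that] show ?thesis unfolding t' by auto
    qed
    then have "inj r"
      by (intro linorder_injI)
    moreover have "finite (range r)"
      using V assms(2) by (meson finite_subset image_subsetI)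
    ultimately show False
      using finite_imageD by blast
  qed
  with legal show ?thesis
    unfolding cops_catch_def by blast
qed

(* The parameter p is a probability only for 0 \<le> p \<le> 1; bernoulli_pmf clamps other values. *)
definition random_subset :: "'a set \<Rightarrow> real \<Rightarrow> 'a set pmf" where
  "random_subset A p =
     map_pmf (\<lambda>b. {x \<in> A. b x}) (Pi_pmf A False (\<lambda>_. bernoulli_pmf p))"

definition random_graph :: "nat \<Rightarrow> real \<Rightarrow> nat pair_pre_digraph pmf" where
  "random_graph n p =
     map_pmf (\<lambda>E. \<lparr>pverts = {..<n}, parcs = {(u, v). {u, v} \<in> E}\<rparr>)
       (random_subset {e. e \<subseteq> {..<n} \<and> card e = 2} p)"

definition random_digraph :: "nat \<Rightarrow> real \<Rightarrow> nat pair_pre_digraph pmf" where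
  "random_digraph n p =
     map_pmf (\<lambda>A. \<lparr>pverts = {..<n}, parcs = A\<rparr>)
       (random_subset {(u, v). u < n \<and> v < n \<and> u \<noteq> v} p)"

end

theory Submission
  imports Defs
begin

text \<open>For \<open>m\<close> about \<open>(1 - \<alpha>) n / 4\<close> a union bound shows that with high probability any two
  disjoint sets of at least \<open>m\<close> vertices are joined by an arc in either direction. On such a graph the robber keeps more than \<open>m\<close>
  vertices reachable along paths that avoid the cops: when a cop lands on the robber, the sets
  reachable from the free successors still cover at least \<open>m\<close> vertices, and if all of them were small,
  some union of them would have size between \<open>m\<close> and \<open>2 m\<close> and no arc to the many other free vertices.\<close>

section \<open>Escaping on expanding digraphs\<close>

text \<open>Asking only for arcs from \<open>A\<close> to \<open>B\<close> covers both directions,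
  because the two sets can be exchanged.\<close>

definition expanding :: "'a set \<Rightarrow> ('a \<times> 'a) set \<Rightarrow> nat \<Rightarrow> bool" where
  "expanding V E m \<longleftrightarrow>
     (\<forall>A B. A \<subseteq> V \<longrightarrow> B \<subseteq> V \<longrightarrow> A \<inter> B = {} \<longrightarrow> m \<le> card A \<longrightarrow> m \<le> card B \<longrightarrow> (A \<times> B) \<inter> E \<noteq> {})"

text \<open>The start vertex itself may lie in the forbidden set, as the robber's position does just after a
  cop has landed on it.\<close>

definition reach :: "('a \<times> 'a) set \<Rightarrow> 'a set \<Rightarrow> 'a \<Rightarrow> 'a set" where
  "reach E X v = (E \<inter> UNIV \<times> - X)\<^sup>* `` {v}"

lemma reach_refl: "v \<in> reach E X v"
  by (simp add: reach_def)

lemma reach_step: "u \<in> reach E X v \<Longrightarrow> (u, z) \<in> E \<Longrightarrow> z \<notin> X \<Longrightarrow> z \<in> reach E X v"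
  by (auto simp: reach_def intro: rtrancl_into_rtrancl)

lemma reach_antimono:
  assumes "Y \<subseteq> X"
  shows "reach E X v \<subseteq> reach E Y v"
proof -
  have "E \<inter> UNIV \<times> - X \<subseteq> E \<inter> UNIV \<times> - Y"
    using assms by auto
  from rtrancl_mono[OF this] show ?thesis
    by (auto simp: reach_def)
qed

lemma reach_subset:
  assumes "E \<subseteq> V \<times> V"
  shows "reach E X v \<subseteq> insert v (V - X)"
proof
  fix z assume "z \<in> reach E X v"
  then have "(v, z) \<in> (E \<inter> UNIV \<times> - X)\<^sup>*"
    by (simp add: reach_def)
  then show "z \<in> insert v (V - X)"
    by (induction rule: rtrancl_induct) (use assms in auto)
qed

text \<open>Cut a path at its last visit to \<open>v\<close>: the rest starts at a free successor of
  \<open>v\<close> and never returns to \<open>v\<close>. So when a cop lands on \<open>v\<close>,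
  the free successors together still reach everything except possibly \<open>v\<close>
  itself.\<close>

lemma reach_via_successor:
  "reach E X v - {v} \<subseteq> (\<Union>w\<in>E `` {v} - insert v X. reach E (insert v X) w)"
proof
  fix z assume z: "z \<in> reach E X v - {v}"
  then have "(v, z) \<in> (E \<inter> UNIV \<times> - X)\<^sup>*"
    by (simp add: reach_def)
  then have "z \<noteq> v \<longrightarrow> (\<exists>w\<in>E `` {v} - insert v X. z \<in> reach E (insert v X) w)"
  proof (induction rule: rtrancl_induct)
    case (step y z)
    show ?case
    proof (cases "y = v")
      case True
      with step show ?thesis
        using reach_refl by fastforce
    next
      case False
      with step show ?thesis
        by (auto intro: reach_step)
    qed
  qed simp
  with z show "z \<in> (\<Union>w\<in>E `` {v} - insert v X. reach E (insert v X) w)"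
    by auto
qed

section \<open>Large reachable sets in expanding digraphs\<close>

text \<open>Add the sets one at a time: the first union of size at least \<open>m\<close> exceeds a
  union of size below \<open>m\<close> by less than \<open>m\<close>.\<close>

lemma subfamily_card_between:
  assumes "finite W" "0 < m" "\<And>w. w \<in> W \<Longrightarrow> card (R w) < m" "m \<le> card (\<Union>w\<in>W. R w)"
  shows "\<exists>W'\<subseteq>W. m \<le> card (\<Union>w\<in>W'. R w) \<and> card (\<Union>w\<in>W'. R w) < 2 * m"
  using assms
proof (induction W rule: finite_induct)
  case (insert w W)
  show ?case
  proof (cases "m \<le> card (\<Union>w\<in>W. R w)")
    case True
    with insert show ?thesis
      by (metis insertCI subset_insertI2)
  next
    case False
    have "card (\<Union>w\<in>insert w W. R w) \<le> card (R w) + card (\<Union>w\<in>W. R w)"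
      by (simp add: card_Un_le)
    also have "\<dots> < 2 * m"
      using False insert.prems(2)[of w] by simp
    finally show ?thesis
      using insert.prems(3) by blast
  qed
qed auto

text \<open>A union of reach sets has no arc to a free vertex outside it. Once it has
  \<open>m\<close> elements, expansion leaves fewer than \<open>m\<close> free vertices outside,
  which forces its size up to at least \<open>2 * m\<close>. Sizes from \<open>m\<close> to
  \<open>2 * m - 1\<close> are thus impossible, so by \<open>subfamily_card_between\<close> one set
  alone is large. The \<open>Suc\<close> makes room in \<open>X\<close> for the robber's current
  vertex beside the occupied ones.\<close>

lemma large_reach:
  assumes fin: "finite V" "finite X" and EV: "E \<subseteq> V \<times> V" and exp: "expanding V E m"
    and m: "0 < m" "card X + 3 * m \<le> Suc (card V)"
    and W: "W \<subseteq> V - X" and large: "m \<le> card (\<Union>w\<in>W. reach E X w)"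
  shows "\<exists>w\<in>W. m < card (reach E X w)"
proof -
  have VX: "card V - card X \<le> card (V - X)"
    using fin by (simp add: diff_card_le_card_Diff)
  have closed: "card (V - X - (\<Union>w\<in>W'. reach E X w)) < m"
    if "W' \<subseteq> W" "m \<le> card (\<Union>w\<in>W'. reach E X w)" for W'
  proof (rule ccontr)
    let ?S = "\<Union>w\<in>W'. reach E X w"
    assume "\<not> card (V - X - ?S) < m"
    moreover have "?S \<subseteq> V"
      using reach_subset[OF EV] that(1) W by blast
    ultimately have "(?S \<times> (V - X - ?S)) \<inter> E \<noteq> {}"
      using exp that(2) unfolding expanding_def
      by (metis Diff_disjoint Diff_subset linorder_not_less subset_trans)
    then show False
      using reach_step by fastforce
  qed
  \<comment> \<open>The subtraction is truncated, but together with the bound on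
    \<open>card X + 3 * m\<close> this still says that the union has at least \<open>2 * m\<close>
    elements.\<close>
  have size: "card V - card X - card (\<Union>w\<in>W'. reach E X w) < m"
    if "W' \<subseteq> W" "m \<le> card (\<Union>w\<in>W'. reach E X w)" for W'
  proof -
    let ?S = "\<Union>w\<in>W'. reach E X w"
    have "?S \<subseteq> V"
      using reach_subset[OF EV] that(1) W by blast
    then have "card (V - X) - card ?S \<le> card (V - X - ?S)"
      using fin finite_subset by (intro diff_card_le_card_Diff) blast
    with closed[OF that] VX show ?thesis by linarith
  qed
  have "\<exists>w\<in>W. m \<le> card (reach E X w)"
  proof (rule ccontr)
    assume "\<not> (\<exists>w\<in>W. m \<le> card (reach E X w))"
    then obtain W' where "W' \<subseteq> W" "m \<le> card (\<Union>w\<in>W'. reach E X w)"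
      "card (\<Union>w\<in>W'. reach E X w) < 2 * m"
      using subfamily_card_between[of W m "reach E X"] large W fin finite_subset m(1)
      by (metis finite_Diff linorder_not_less)
    with size[of W'] m show False by linarith
  qed
  then obtain w where "w \<in> W" "m \<le> card (reach E X w)" by blast
  \<comment> \<open>For a single set, \<open>size\<close> raises \<open>m\<close> to
    \<open>2 * m\<close>. The strict gain over \<open>m\<close> pays for the vertex that the robber
    loses in his next move.\<close>
  with size[of "{w}"] m show ?thesis
    by (intro bexI[of _ w]) auto
qed

section \<open>The robber's escape from \<open>k\<close> cops\<close>

text \<open>The robber always keeps more than \<open>m\<close> vertices in reach off the occupied
  set. \<open>large_reach\<close> restores this after every move of the cops, and dependent choice
  turns the single steps into an infinite escape.\<close>

lemma expanding_not_cops_catch: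
  assumes fin: "finite (pverts G)" and EV: "parcs G \<subseteq> pverts G \<times> pverts G"
    and exp: "expanding (pverts G) (parcs G) m"
    and m: "0 < m" "k + 3 * m \<le> card (pverts G)"
  shows "\<not> cops_catch G k"
  unfolding cops_catch_def
proof safe
  fix \<sigma> :: "'a cop_strategy"
  assume legal: "\<forall>h i. \<sigma> h = Some i \<longrightarrow> i < k" and no: "\<nexists>r. robber_escapes G \<sigma> r"
  let ?V = "pverts G" and ?E = "parcs G"
  define occ where "occ c = {v. \<exists>i::nat. c i = Some v}" for c :: "nat \<Rightarrow> 'a option"
  define move where "move h c = (case \<sigma> h of None \<Rightarrow> c | Some i \<Rightarrow> c(i := Some (last h)))"
    for h :: "'a list" and c
  \<comment> \<open>A state is the robber's history together with the cop positions just before the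
    cops' next move. Indices from \<open>k\<close> on hold \<open>None\<close>, so at most
    \<open>k\<close> vertices are occupied.\<close>
  define inv where "inv s \<longleftrightarrow> fst s \<noteq> [] \<and> last (fst s) \<in> ?V \<and> (\<forall>i\<ge>k. snd s i = None)
      \<and> m < card (reach ?E (occ (snd s)) (last (fst s)))" for s :: "'a list \<times> (nat \<Rightarrow> 'a option)"
  define nxt where "nxt s s' \<longleftrightarrow> (\<exists>w. s' = (fst s @ [w], move (fst s) (snd s))
      \<and> (last (fst s), w) \<in> ?E \<and> w \<notin> occ (snd s'))" for s s'
  have occ: "finite (occ c)" "card (occ c) \<le> k" if "\<forall>i\<ge>k. c i = None" for c
  proof -
    have sub: "occ c \<subseteq> (\<lambda>i. the (c i)) ` {..<k}"
    proof
      fix v assume "v \<in> occ c"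
      then obtain i where i: "c i = Some v" by (auto simp: occ_def)
      then have "i < k" using that by (metis linorder_not_less option.distinct(1))
      with i show "v \<in> (\<lambda>i. the (c i)) ` {..<k}" by force
    qed
    then show "finite (occ c)" using finite_surj by blast
    have "card (occ c) \<le> card ((\<lambda>i. the (c i)) ` {..<k})"
      using sub by (intro card_mono) auto
    also have "\<dots> \<le> k" using card_image_le[of "{..<k}"] by simp
    finally show "card (occ c) \<le> k" .
  qed
  \<comment> \<open>Every vertex reaches itself, so before any cop has landed the reach sets cover
    \<open>?V\<close>, and \<open>large_reach\<close> with empty \<open>X\<close> yields the
    start.\<close>
  have start: "\<exists>v. inv ([v], \<lambda>_. None)"
  proof -
    have "?V \<subseteq> (\<Union>w\<in>?V. reach ?E {} w)"
      using reach_refl by fast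
    moreover have "finite (\<Union>w\<in>?V. reach ?E {} w)"
      by (rule finite_subset[OF _ fin]) (use reach_subset[OF EV] in blast)
    ultimately have "card ?V \<le> card (\<Union>w\<in>?V. reach ?E {} w)"
      by (rule card_mono[rotated])
    with m have "m \<le> card (\<Union>w\<in>?V. reach ?E {} w)" by linarith
    then obtain w where "w \<in> ?V" "m < card (reach ?E {} w)"
      using large_reach[of ?V "{}" ?E m ?V] fin EV exp m by auto
    then show ?thesis
      by (auto simp: inv_def occ_def)
  qed
  have step: "\<exists>s'. inv s' \<and> nxt s s'" if "inv s" for s
  proof -
    obtain h c where s: "s = (h, c)" by force
    let ?v = "last h" and ?X = "occ c"
    from that have hc: "?v \<in> ?V" "\<forall>i\<ge>k. c i = None" "m < card (reach ?E ?X ?v)"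
      by (auto simp: inv_def s)
    \<comment> \<open>\<open>?Y\<close> contains every vertex occupied after the cops' move, whether
      they stay or one flies to \<open>?v\<close>. One choice of \<open>w\<close> suits both cases,
      and a cop leaving its old place only enlarges the reach.\<close>
    let ?Y = "insert ?v ?X" and ?W = "?E `` {?v} - insert ?v ?X"
    have WV: "?W \<subseteq> ?V - ?Y" using EV by auto
    have finU: "finite (\<Union>w\<in>?W. reach ?E ?Y w)"
      by (rule finite_subset[OF _ fin]) (use reach_subset[OF EV] WV in blast)
    \<comment> \<open>The strict inequality in \<open>inv\<close> leaves \<open>m\<close> vertices
      after the removal of \<open>?v\<close>.\<close>
    have "m \<le> card (reach ?E ?X ?v - {?v})"
      using hc(3) by (auto simp: card_Diff_singleton_if)
    also have "\<dots> \<le> card (\<Union>w\<in>?W. reach ?E ?Y w)"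
      using finU reach_via_successor by (rule card_mono)
    finally have "m \<le> card (\<Union>w\<in>?W. reach ?E ?Y w)" .
    moreover have "card ?Y + 3 * m \<le> Suc (card ?V)"
      using occ[OF hc(2)] m(2) by (simp add: card_insert_if)
    ultimately obtain w where w: "w \<in> ?W" "m < card (reach ?E ?Y w)"
      using large_reach[of ?V ?Y ?E m ?W] fin EV exp m WV occ(1)[OF hc(2)] by blast
    let ?c = "move h c"
    have Y: "occ ?c \<subseteq> ?Y"
      by (auto simp: occ_def move_def split: option.splits if_splits)
    have wV: "w \<in> ?V" using w WV by auto
    have "reach ?E (occ ?c) w \<subseteq> ?V"
      using reach_subset[OF EV] wV by blast
    then have "card (reach ?E ?Y w) \<le> card (reach ?E (occ ?c) w)"
      using reach_antimono[OF Y] finite_subset[OF _ fin] by (simp add: card_mono)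
    then have "inv (h @ [w], ?c)"
      using w wV hc(2) legal
      by (auto simp: inv_def move_def dest!: spec[of _ h] split: option.splits)
    moreover have "nxt s (h @ [w], ?c)"
      using w Y by (auto simp: nxt_def s)
    ultimately show ?thesis by blast
  qed
  obtain v where v: "inv ([v], \<lambda>_. None)" using start by blast
  \<comment> \<open>The clause for \<open>t = 0\<close> makes the sequence start with all cops
    outside, as \<open>cop_position\<close> prescribes.\<close>
  have "\<exists>f. \<forall>t. (inv (f t) \<and> (t = 0 \<longrightarrow> f t = ([v], \<lambda>_. None))) \<and> nxt (f t) (f (Suc t))"
    by (rule dependent_nat_choice) (use v step in auto)
  then obtain f where f0: "f 0 = ([v], \<lambda>_. None)" and f: "inv (f t)" "nxt (f t) (f (Suc t))" for t
    by metis
  define r where "r t = last (fst (f t))" for t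
  \<comment> \<open>The chosen states carry their own histories and cop positions; these must agree
    with what \<open>cop_position\<close> computes from the finished trajectory
    \<open>r\<close>.\<close>
  have hist: "f t = (map r [0..<Suc t], cop_position \<sigma> r t)" for t
  proof (induction t)
    case 0
    then show ?case by (simp add: f0 r_def)
  next
    case (Suc t)
    obtain w where w: "f (Suc t) = (fst (f t) @ [w], move (fst (f t)) (snd (f t)))"
      using f(2)[of t] by (auto simp: nxt_def)
    then have "r (Suc t) = w" by (simp add: r_def)
    with w Suc show ?case by (simp add: move_def split: option.splits)
  qed
  have "robber_escapes G \<sigma> r"
    unfolding robber_escapes_def
  proof (intro conjI allI)
    show "r 0 \<in> pverts G" using v by (simp add: r_def f0 inv_def)
  next
    fix t
    show "(r t, r (Suc t)) \<in> parcs G"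
      using f(2)[of t] by (auto simp: nxt_def r_def)
  next
    fix t i
    have "r (Suc t) \<notin> occ (snd (f (Suc t)))"
      using f(2)[of t] by (auto simp: nxt_def r_def)
    then show "cop_position \<sigma> r (Suc t) i \<noteq> Some (r (Suc t))"
      unfolding hist occ_def by auto
  qed
  with no show False by blast
qed

text \<open>The least winning number is attained, since \<open>card (pverts G)\<close> cops win.
  Were it at most \<open>k\<close>, it would satisfy the same size bound, against
  \<open>expanding_not_cops_catch\<close>.\<close>

lemma expanding_entanglement_gt:
  assumes wf: "pair_wf_digraph G" and fin: "finite (pverts G)"
    and exp: "expanding (pverts G) (parcs G) m"
    and m: "0 < m" "k + 3 * m \<le> card (pverts G)"
  shows "k < entanglement G"
proof (rule ccontr)
  interpret pair_wf_digraph G by fact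
  assume "\<not> k < entanglement G"
  moreover have "cops_catch G (entanglement G)"
    unfolding entanglement_def by (rule LeastI) (rule cops_catch_card[OF wf fin])
  moreover have "parcs G \<subseteq> pverts G \<times> pverts G"
    using in_arcsD1 in_arcsD2 by auto
  ultimately show False
    using expanding_not_cops_catch[OF fin _ exp m(1), of "entanglement G"] m(2) by simp
qed

section \<open>Expansion of random graphs\<close>

text \<open>The event is a box in the product measure: coordinates in \<open>S\<close> are forced to
  \<open>False\<close>, all others are free.\<close>

lemma prob_random_subset_disjoint:
  assumes "finite U" "S \<subseteq> U" "0 \<le> p" "p \<le> 1"
  shows "measure_pmf.prob (random_subset U p) {T. T \<inter> S = {}} = (1 - p) ^ card S"
proof -
  let ?B = "\<lambda>x. if x \<in> S then {False} else UNIV"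
  have "measure_pmf.prob (random_subset U p) {T. T \<inter> S = {}}
      = measure_pmf.prob (Pi_pmf U False (\<lambda>_. bernoulli_pmf p)) (Pi U ?B)"
    unfolding random_subset_def measure_map_pmf
    using assms(2) by (intro arg_cong[where f = "measure_pmf.prob _"]) (auto simp: Pi_iff split: if_splits)
  also have "\<dots> = (\<Prod>x\<in>U. measure_pmf.prob (bernoulli_pmf p) (?B x))"
    using assms(1) by (rule measure_Pi_pmf_Pi)
  also have "\<dots> = (\<Prod>x\<in>U. if x \<in> S then 1 - p else 1)"
    using assms(3,4) by (intro prod.cong) (auto simp: measure_pmf_single)
  also have "\<dots> = (1 - p) ^ card S"
    using assms(1,2) by (simp add: prod.If_cases Int_absorb1)
  finally show ?thesis .
qed

text \<open>Here \<open>e\<close> sends a possible arc to the random element that decides it.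
  Injectivity on \<open>A \<times> B\<close> gives at least \<open>m * m\<close> independent trials,
  all failing with probability at most \<open>exp (- p * m * m)\<close>; the union bound runs over
  at most \<open>4 ^ card V\<close> pairs of subsets.\<close>

lemma prob_not_expanding_le:
  fixes e :: "'v \<times> 'v \<Rightarrow> 'a"
  assumes "finite V" "finite U" "0 \<le> p" "p \<le> 1"
    and e: "\<And>A B. A \<subseteq> V \<Longrightarrow> B \<subseteq> V \<Longrightarrow> A \<inter> B = {} \<Longrightarrow> e ` (A \<times> B) \<subseteq> U \<and> inj_on e (A \<times> B)"
  shows "measure_pmf.prob (random_subset U p) {T. \<not> expanding V (e -` T) m}
      \<le> 4 ^ card V * exp (- p * real m ^ 2)"
proof -
  define I where "I = {(A, B). A \<subseteq> V \<and> B \<subseteq> V \<and> A \<inter> B = {} \<and> m \<le> card A \<and> m \<le> card B}"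
  let ?D = "\<lambda>(A, B). {T. T \<inter> e ` (A \<times> B) = {}}"
  have I: "I \<subseteq> Pow V \<times> Pow V" by (auto simp: I_def)
  then have finI: "finite I"
    by (rule finite_subset) (use assms(1) in simp)
  have "card I \<le> card (Pow V \<times> Pow V)"
    using I assms(1) by (intro card_mono) auto
  also have "\<dots> = 4 ^ card V"
    using assms(1) by (simp add: card_cartesian_product card_Pow flip: power_mult_distrib)
  finally have "card I \<le> 4 ^ card V" .
  then have cardI: "real (card I) \<le> 4 ^ card V"
    by (metis of_nat_le_iff of_nat_numeral of_nat_power)
  have single: "measure_pmf.prob (random_subset U p) (?D x) \<le> exp (- p * real m ^ 2)"
    if "x \<in> I" for x
  proof -
    obtain A B where x: "x = (A, B)" by force
    with that have AB: "A \<subseteq> V" "B \<subseteq> V" "A \<inter> B = {}" "m \<le> card A" "m \<le> card B"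
      by (auto simp: I_def)
    have "measure_pmf.prob (random_subset U p) (?D x) = (1 - p) ^ card (e ` (A \<times> B))"
      unfolding x prod.case using assms e AB by (intro prob_random_subset_disjoint) auto
    also have "card (e ` (A \<times> B)) = card A * card B"
      using e[of A B] AB by (simp add: card_image card_cartesian_product)
    also have "(1 - p) ^ (card A * card B) \<le> (1 - p) ^ (m * m)"
      using AB assms by (intro power_decreasing mult_mono) auto
    also have "\<dots> \<le> exp (- p) ^ (m * m)"
      using assms exp_ge_add_one_self[of "-p"] by (intro power_mono) auto
    also have "\<dots> = exp (- p * real m ^ 2)"
      by (simp add: power2_eq_square algebra_simps flip: exp_of_nat_mult)
    finally show ?thesis .
  qed
  have "{T. \<not> expanding V (e -` T) m} \<subseteq> (\<Union>x\<in>I. ?D x)"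
  proof
    fix T assume "T \<in> {T. \<not> expanding V (e -` T) m}"
    then obtain A B where AB: "A \<subseteq> V" "B \<subseteq> V" "A \<inter> B = {}" "m \<le> card A" "m \<le> card B"
      and "(A \<times> B) \<inter> e -` T = {}"
      unfolding expanding_def by auto
    from this(6) have "T \<inter> e ` (A \<times> B) = {}" by blast
    moreover from AB have "(A, B) \<in> I" by (simp add: I_def)
    ultimately show "T \<in> (\<Union>x\<in>I. ?D x)" by blast
  qed
  then have "measure_pmf.prob (random_subset U p) {T. \<not> expanding V (e -` T) m}
      \<le> measure_pmf.prob (random_subset U p) (\<Union>x\<in>I. ?D x)"
    by (intro measure_pmf.finite_measure_mono) auto
  also have "\<dots> \<le> (\<Sum>x\<in>I. measure_pmf.prob (random_subset U p) (?D x))"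
    using finI by (intro measure_pmf.finite_measure_subadditive_finite) auto
  also have "\<dots> \<le> real (card I) * exp (- p * real m ^ 2)"
    using single by (intro sum_bounded_above)
  also have "\<dots> \<le> 4 ^ card V * exp (- p * real m ^ 2)"
    using cardI by (intro mult_right_mono) simp_all
  finally show ?thesis .
qed

section \<open>Linear entanglement with high probability\<close>

text \<open>Both models are instances, for suitable \<open>e\<close>. With \<open>m\<close> at least
  \<open>(1 - \<alpha>) * n / 8\<close>, the constant 128 gives
  \<open>p * m * m \<ge> 2 * n\<close>, and the failure probability is at most
  \<open>(4 * exp (-2)) ^ n\<close>.\<close>

lemma entanglement_linear_whp:
  fixes e :: "nat \<times> nat \<Rightarrow> 'a" and U :: "nat \<Rightarrow> 'a set" and p :: "nat \<Rightarrow> real"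
  assumes \<alpha>: "0 < \<alpha>" "\<alpha> < 1"
    and p: "\<forall>\<^sub>F n in sequentially. 128 / (1 - \<alpha>)\<^sup>2 / real n \<le> p n \<and> p n \<le> 1"
    and finU: "\<And>n. finite (U n)"
    and arcs: "\<And>n u v. e (u, v) \<in> U n \<Longrightarrow> u < n \<and> v < n"
    and e: "\<And>n A B. A \<subseteq> {..<n} \<Longrightarrow> B \<subseteq> {..<n} \<Longrightarrow> A \<inter> B = {} \<Longrightarrow>
              e ` (A \<times> B) \<subseteq> U n \<and> inj_on e (A \<times> B)"
  shows "(\<lambda>n. measure_pmf.prob
            (map_pmf (\<lambda>T. \<lparr>pverts = {..<n}, parcs = e -` T\<rparr>) (random_subset (U n) (p n)))
            {G. real (entanglement G) > \<alpha> * real n}) \<longlonglongrightarrow> 1" (is "?P \<longlonglongrightarrow> 1")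
proof (rule tendsto_sandwich)
  \<comment> \<open>\<open>3 * m\<close> takes at most three quarters of the
    \<open>(1 - \<alpha>) * n\<close> vertices left beside \<open>\<alpha> * n\<close> cops.\<close>
  define m where "m n = nat \<lfloor>(1 - \<alpha>) * real n / 4\<rfloor>" for n
  \<comment> \<open>From here on the number under the floor in \<open>m\<close> is at least 2, so
    rounding loses at most half of it.\<close>
  have "\<forall>\<^sub>F n in sequentially. real n \<ge> 8 / (1 - \<alpha>)"
    using filterlim_real_sequentially by (simp add: filterlim_at_top)
  then have large: "\<forall>\<^sub>F n in sequentially. (1 - \<alpha>) * real n \<ge> 8"
    by eventually_elim (use \<alpha> in \<open>simp add: field_simps\<close>)
  show "\<forall>\<^sub>F n in sequentially. 1 - (4 * exp (-2)) ^ n \<le> ?P n"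
    using large p
  proof eventually_elim
    case (elim n)
    let ?M = "random_subset (U n) (p n)"
    have n: "real n > 0" using elim(1) by (cases "n = 0") auto
    have p0: "0 \<le> p n"
      using elim(2) n by (meson order_trans divide_nonneg_nonneg zero_le_power2 of_nat_0_le_iff zero_le_numeral)
    have mle: "real (m n) \<le> (1 - \<alpha>) * real n / 4" and mge: "(1 - \<alpha>) * real n / 8 \<le> real (m n)"
      using elim(1) unfolding m_def by linarith+
    have mpos: "0 < m n" using mge elim(1) by linarith
    have scale: "128 / c\<^sup>2 / x * (c * x / 8)\<^sup>2 = 2 * x" if "c \<noteq> 0" "x \<noteq> 0" for c x :: real
      using that by (simp add: field_simps power2_eq_square)
    have "2 * real n = 128 / (1 - \<alpha>)\<^sup>2 / real n * ((1 - \<alpha>) * real n / 8)\<^sup>2"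
      using scale[of "1 - \<alpha>" "real n"] \<alpha> n by simp
    also have "\<dots> \<le> p n * real (m n) ^ 2"
      using elim(2) p0 mge \<alpha> by (intro mult_mono power_mono) auto
    finally have pm: "2 * real n \<le> p n * real (m n) ^ 2" .
    \<comment> \<open>As \<open>k\<close> is the floor of \<open>\<alpha> * n\<close>, any integer
      above \<open>k\<close> exceeds \<open>\<alpha> * n\<close>.\<close>
    define k where "k = nat \<lfloor>\<alpha> * real n\<rfloor>"
    have k: "real k \<le> \<alpha> * real n" "\<alpha> * real n < real k + 1"
      using \<alpha> unfolding k_def by (auto simp: of_nat_nat)
    have "real k + 3 * real (m n) \<le> real n"
    proof -
      have "real k + 3 * real (m n) \<le> \<alpha> * real n + 3 * ((1 - \<alpha>) * real n / 4)"
        using k mle by linarith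
      also have "\<dots> = real n - (1 - \<alpha>) * real n / 4" by (simp add: field_simps)
      also have "\<dots> \<le> real n" using elim(1) by simp
      finally show ?thesis .
    qed
    then have km: "k + 3 * m n \<le> n" by linarith
    have ent: "\<alpha> * real n < real (entanglement \<lparr>pverts = {..<n}, parcs = e -` T\<rparr>)"
      if T: "T \<subseteq> U n" "expanding {..<n} (e -` T) (m n)" for T
    proof -
      let ?G = "\<lparr>pverts = {..<n}, parcs = e -` T\<rparr>"
      have "pair_wf_digraph ?G"
        using arcs T(1) by unfold_locales auto
      then have "k < entanglement ?G"
        using T(2) mpos km by (intro expanding_entanglement_gt[of _ "m n"]) auto
      with k show ?thesis by linarith
    qed
    have "measure_pmf.prob ?M {T. \<not> expanding {..<n} (e -` T) (m n)} \<le> 4 ^ n * exp (- p n * real (m n) ^ 2)"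
      using prob_not_expanding_le[of "{..<n}" "U n" "p n" e "m n"] finU p0 elim(2) e by simp
    also have "\<dots> \<le> 4 ^ n * exp (- 2 * real n)"
      using pm by simp
    also have "\<dots> = (4 * exp (-2)) ^ n"
      by (simp add: power_mult_distrib mult.commute flip: exp_of_nat_mult)
    finally have "1 - (4 * exp (-2)) ^ n \<le> 1 - measure_pmf.prob ?M {T. \<not> expanding {..<n} (e -` T) (m n)}"
      by simp
    also have "\<dots> = measure_pmf.prob ?M {T. expanding {..<n} (e -` T) (m n)}"
      by (subst measure_pmf.prob_compl[symmetric])
        (auto intro: arg_cong[where f = "measure_pmf.prob ?M"])
    also have "\<dots> \<le> ?P n"
      unfolding measure_map_pmf
    proof (rule measure_pmf.finite_measure_mono_AE)
      \<comment> \<open>Only samples inside \<open>U n\<close> are sure to give well-formed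
        digraphs, so the events are compared almost everywhere.\<close>
      have "T \<subseteq> U n" if "T \<in> set_pmf ?M" for T
        using that by (auto simp: random_subset_def)
      then show "AE T in measure_pmf ?M. T \<in> {T. expanding {..<n} (e -` T) (m n)} \<longrightarrow>
          T \<in> (\<lambda>T. \<lparr>pverts = {..<n}, parcs = e -` T\<rparr>) -` {G. real (entanglement G) > \<alpha> * real n}"
        using ent by (auto simp: AE_measure_pmf_iff)
    qed simp
    finally show ?case .
  qed
  \<comment> \<open>The quadratic Taylor bound gives \<open>exp 2 \<ge> 1 + 2 + 2\<close>, so the
    failure bound decays geometrically.\<close>
  have "(4::real) < exp 2"
    using exp_lower_Taylor_quadratic[of "2::real"] by simp
  then have "\<bar>4 * exp (-2) :: real\<bar> < 1"
    by (simp add: exp_minus field_simps)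
  then have "(\<lambda>n. (4 * exp (-2) :: real) ^ n) \<longlonglongrightarrow> 0"
    by (intro LIMSEQ_power_zero) simp
  from tendsto_diff[OF tendsto_const this]
  show "(\<lambda>n. 1 - (4 * exp (-2) :: real) ^ n) \<longlonglongrightarrow> 1" by simp
qed auto

text \<open>Each arc is its own trial, so \<open>e\<close> is the identity.\<close>

lemma random_digraph_entanglement_whp:
  assumes "0 < \<alpha>" "\<alpha> < 1"
    and "\<forall>\<^sub>F n in sequentially. 128 / (1 - \<alpha>)\<^sup>2 / real n \<le> p n \<and> p n \<le> 1"
  shows "(\<lambda>n. measure_pmf.prob (random_digraph n (p n))
            {G. real (entanglement G) > \<alpha> * real n}) \<longlonglongrightarrow> 1"
proof -
  have fin: "finite {(u, v). u < n \<and> v < n \<and> u \<noteq> v}" for n :: nat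
    by (rule finite_subset[of _ "{..<n} \<times> {..<n}"]) auto
  have "random_digraph n q = map_pmf (\<lambda>T. \<lparr>pverts = {..<n}, parcs = (\<lambda>a. a) -` T\<rparr>)
      (random_subset {(u, v). u < n \<and> v < n \<and> u \<noteq> v} q)" for n q
    by (simp add: random_digraph_def vimage_def)
  then show ?thesis
    using assms fin by (simp only:) (rule entanglement_linear_whp, auto)
qed

text \<open>Here \<open>e\<close> forgets the orientation. For disjoint \<open>A\<close> and
  \<open>B\<close> it stays injective on \<open>A \<times> B\<close>, because the end lying in
  \<open>A\<close> can be recognised.\<close>

lemma random_graph_entanglement_whp:
  assumes "0 < \<alpha>" "\<alpha> < 1"
    and "\<forall>\<^sub>F n in sequentially. 128 / (1 - \<alpha>)\<^sup>2 / real n \<le> p n \<and> p n \<le> 1"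
  shows "(\<lambda>n. measure_pmf.prob (random_graph n (p n))
            {G. real (entanglement G) > \<alpha> * real n}) \<longlonglongrightarrow> 1"
proof -
  have edges: "(\<lambda>(u, v). {u, v}) ` (A \<times> B) \<subseteq> {e. e \<subseteq> {..<n} \<and> card e = 2}
      \<and> inj_on (\<lambda>(u, v). {u, v}) (A \<times> B)"
    if "A \<subseteq> {..<n}" "B \<subseteq> {..<n}" "A \<inter> B = {}" for A B and n :: nat
  proof -
    have "card {a, b} = 2" if "a \<in> A" "b \<in> B" for a b
    proof -
      have "a \<noteq> b" using that \<open>A \<inter> B = {}\<close> by blast
      then show ?thesis by simp
    qed
    then show ?thesis
      using that by (auto simp: inj_on_def doubleton_eq_iff)
  qed
  have "random_graph n q = map_pmf (\<lambda>T. \<lparr>pverts = {..<n}, parcs = (\<lambda>(u, v). {u, v}) -` T\<rparr>)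
      (random_subset {e. e \<subseteq> {..<n} \<and> card e = 2} q)" for n q
    by (simp add: random_graph_def vimage_def case_prod_unfold)
  then show ?thesis
    using assms edges by (simp only:) (rule entanglement_linear_whp, auto)
qed

theorem theorem1:
  shows "(\<forall>\<alpha>::real. 0 < \<alpha> \<and> \<alpha> < 1 \<longrightarrow>
           (\<exists>C>0. \<forall>p :: nat \<Rightarrow> real.
              (\<forall>\<^sub>F n in sequentially. C / real n \<le> p n \<and> p n \<le> 1) \<longrightarrow>
              (\<lambda>n. measure_pmf.prob (random_graph n (p n))
                     {G. real (entanglement G) > \<alpha> * real n}) \<longlonglongrightarrow> 1))
       \<and> (\<forall>\<alpha>::real. 0 < \<alpha> \<and> \<alpha> < 1 \<longrightarrow>
           (\<exists>C>0. \<forall>p :: nat \<Rightarrow> real.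
              (\<forall>\<^sub>F n in sequentially. C / real n \<le> p n \<and> p n \<le> 1) \<longrightarrow>
              (\<lambda>n. measure_pmf.prob (random_digraph n (p n))
                     {G. real (entanglement G) > \<alpha> * real n}) \<longlonglongrightarrow> 1))"
proof (intro conjI allI impI)
  fix \<alpha> :: real assume \<alpha>: "0 < \<alpha> \<and> \<alpha> < 1"
  \<comment> \<open>This constant depends on \<open>\<alpha>\<close> alone and serves both
    models.\<close>
  then have C: "128 / (1 - \<alpha>)\<^sup>2 > 0" by simp
  show "\<exists>C>0. \<forall>p :: nat \<Rightarrow> real. (\<forall>\<^sub>F n in sequentially. C / real n \<le> p n \<and> p n \<le> 1) \<longrightarrow>
          (\<lambda>n. measure_pmf.prob (random_graph n (p n))
                 {G. real (entanglement G) > \<alpha> * real n}) \<longlonglongrightarrow> 1"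
    using C \<alpha> random_graph_entanglement_whp by blast
  show "\<exists>C>0. \<forall>p :: nat \<Rightarrow> real. (\<forall>\<^sub>F n in sequentially. C / real n \<le> p n \<and> p n \<le> 1) \<longrightarrow>
          (\<lambda>n. measure_pmf.prob (random_digraph n (p n))
                 {G. real (entanglement G) > \<alpha> * real n}) \<longlonglongrightarrow> 1"
    using C \<alpha> random_digraph_entanglement_whp by blast
qed

end
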